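(* Given a function $r(x)>1$ on $[a,b]$, the function $$f(x) = \exp\left(\pm C\int_a^x \sqrt{r^2(t)-1}\,dt\right),$$ where $C$ is a constant, is a positive function such that $f(x)/\mathcal{AM}(f)(x)=r(x)$.
   Context: The Amplitude Modulation transform of a function $f$ is $\mathcal{AM}(f)(x)=\frac{f^2(x)}{\sqrt{f^2(x)+f'(x)^2}}$.
   Formalization: The claim fails for arbitrary C (r=2, C=0 gives ratio 1); it is proved that the printed f works exactly when |C|=1, and that exp(C ± ∫) works for every C. Also r is assumed continuous and a<b, as f need not be differentiable where r jumps. *)

theory Defs
  imports "HOL-Analysis.Analysis"
begin

text \<open>
  The amplitude modulation transform of a function on \<open>S\<close>. The derivative is taken within \<open>S\<close>,
  i.e. it is one-sided at the end points of a closed interval.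
\<close>
definition AM :: "real set \<Rightarrow> (real \<Rightarrow> real) \<Rightarrow> real \<Rightarrow> real" where
  "AM S f x = (f x)\<^sup>2 / sqrt ((f x)\<^sup>2 + (vector_derivative f (at x within S))\<^sup>2)"

end

theory Submission
  imports Defs
begin

text \<open>
  If \<open>h' = u h\<close> with \<open>h > 0\<close>, then \<open>h / AM h = sqrt (1 + u\<^sup>2)\<close>. Both families of functions satisfy
  this with \<open>u\<close> a constant multiple of \<open>sqrt (r\<^sup>2 - 1)\<close>; the quotient is \<open>r\<close> exactly when that constant
  has modulus 1.
\<close>

lemma divide_AM_eq:
  fixes h :: "real \<Rightarrow> real"
  assumes "a < b" and "x \<in> {a..b}" and "h x > 0"
    and deriv: "(h has_vector_derivative u * h x) (at x within {a..b})"
  shows "h x / AM {a..b} h x = sqrt (1 + u\<^sup>2)"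
proof -
  \<comment> \<open>\<open>vector_derivative\<close> is a choice among derivatives;
    \<open>a < b\<close> makes derivatives within the interval unique, also at its end
    points.\<close>
  have "vector_derivative h (at x within {a..b}) = u * h x"
    using vector_derivative_within_cbox[of a b x h "u * h x"] assms by simp
  moreover have "(h x)\<^sup>2 + (u * h x)\<^sup>2 = (h x)\<^sup>2 * (1 + u\<^sup>2)"
    by (simp add: power_mult_distrib algebra_simps)
  then have "sqrt ((h x)\<^sup>2 + (u * h x)\<^sup>2) = h x * sqrt (1 + u\<^sup>2)"
    using \<open>h x > 0\<close> by (simp add: real_sqrt_mult)
  ultimately show ?thesis
    using \<open>h x > 0\<close> by (simp add: AM_def power2_eq_square)
qed

text \<open>Fundamental theorem of calculus, then the chain rule. The additive \<open>c\<close>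
  survives only inside the factor \<open>h x\<close>, so the logarithmic derivative is
  \<open>k * q x\<close> whatever \<open>c\<close> is.\<close>

lemma has_vector_derivative_exp_integral:
  fixes h q :: "real \<Rightarrow> real"
  assumes "continuous_on {a..b} q" and "x \<in> {a..b}"
    and h: "\<forall>y\<in>{a..b}. h y = exp (c + k * integral {a..y} q)"
  shows "(h has_vector_derivative k * q x * h x) (at x within {a..b})"
proof -
  have "((\<lambda>y. integral {a..y} q) has_real_derivative q x) (at x within {a..b})"
    using integral_has_vector_derivative[OF assms(1,2)]
    by (simp add: has_real_derivative_iff_has_vector_derivative)
  then have "((\<lambda>y. exp (c + k * integral {a..y} q)) has_real_derivative
      exp (c + k * integral {a..x} q) * (k * q x)) (at x within {a..b})"
    by (auto intro!: derivative_eq_intros)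
  then have "((\<lambda>y. exp (c + k * integral {a..y} q)) has_vector_derivative k * q x * h x)
      (at x within {a..b})"
    using assms(2) h by (simp add: has_real_derivative_iff_has_vector_derivative mult_ac)
  \<comment> \<open>The formula for \<open>h\<close> is known only on \<open>{a..b}\<close>, which
    suffices for a derivative within that set.\<close>
  then show ?thesis
    by (rule has_vector_derivative_transform[OF assms(2), rotated]) (use h in auto)
qed

text \<open>Serves both families: \<open>c = 0\<close>, \<open>k = s * C\<close> for
  \<open>f\<close>, and \<open>c = C\<close>, \<open>k = s\<close> for \<open>g\<close>.\<close>

lemma exp_integral_divide_AM:
  fixes h r :: "real \<Rightarrow> real"
  assumes "a < b" and "continuous_on {a..b} r" and r: "\<forall>x\<in>{a..b}. r x > 1"
    and h: "\<forall>x\<in>{a..b}. h x = exp (c + k * integral {a..x} (\<lambda>t. sqrt ((r t)\<^sup>2 - 1)))"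
  shows "h differentiable_on {a..b}"
    and "(\<forall>x\<in>{a..b}. h x / AM {a..b} h x = r x) \<longleftrightarrow> \<bar>k\<bar> = 1"
proof -
  have "continuous_on {a..b} (\<lambda>t. sqrt ((r t)\<^sup>2 - 1))"
    by (intro continuous_intros assms(2))
  then have deriv: "(h has_vector_derivative k * sqrt ((r x)\<^sup>2 - 1) * h x) (at x within {a..b})"
    if "x \<in> {a..b}" for x
    using has_vector_derivative_exp_integral that h by blast
  show "h differentiable_on {a..b}"
    unfolding differentiable_on_def
    using deriv has_vector_derivative_def differentiable_def by metis
  have iff: "h x / AM {a..b} h x = r x \<longleftrightarrow> \<bar>k\<bar> = 1" if x: "x \<in> {a..b}" for x
  proof -
    have r1: "r x > 1" and "(r x)\<^sup>2 > 1"
      using r x by (auto simp: one_less_power)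
    have "h x / AM {a..b} h x = sqrt (1 + (k * sqrt ((r x)\<^sup>2 - 1))\<^sup>2)"
      by (rule divide_AM_eq[OF assms(1) x _ deriv[OF x]]) (use h x in simp)
    also have "\<dots> = sqrt (1 + k\<^sup>2 * ((r x)\<^sup>2 - 1))"
      using \<open>(r x)\<^sup>2 > 1\<close> by (simp add: power_mult_distrib)
    also have "\<dots> = r x \<longleftrightarrow> 1 + k\<^sup>2 * ((r x)\<^sup>2 - 1) = (r x)\<^sup>2"
      using r1 real_sqrt_eq_iff[of _ "(r x)\<^sup>2"] by simp
    \<comment> \<open>Since \<open>r x > 1\<close>, the second factor cannot vanish, so each single
      point already decides whether \<open>k\<close> has modulus 1.\<close>
    also have "\<dots> \<longleftrightarrow> (k\<^sup>2 - 1) * ((r x)\<^sup>2 - 1) = 0"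
      by (simp only: algebra_simps) linarith
    also have "\<dots> \<longleftrightarrow> \<bar>k\<bar> = 1"
      using r1 by (auto simp: power2_eq_1_iff)
    finally show ?thesis .
  qed
  \<comment> \<open>A point of the interval is required to get \<bar>k\<bar> = 1 from the
    universally quantified equation.\<close>
  have "a \<in> {a..b}"
    using \<open>a < b\<close> by simp
  with iff show "(\<forall>x\<in>{a..b}. h x / AM {a..b} h x = r x) \<longleftrightarrow> \<bar>k\<bar> = 1"
    by blast
qed

text \<open>In \<open>f\<close> the constant multiplies the integral and so rescales the logarithmic
  derivative, which restricts \<open>C\<close>. In \<open>g\<close> it is a constant of integration,
  a positive factor \<open>exp C\<close> that cancels in the quotient, so every \<open>C\<close> is
  allowed.\<close>

theorem mainTheorem5:
  fixes r f g :: "real \<Rightarrow> real" and a b C s :: real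
  assumes "a < b"
    and "continuous_on {a..b} r"
    and "\<forall>x\<in>{a..b}. r x > 1"
    and "s \<in> {1, -1}"
    and "\<forall>x\<in>{a..b}. f x = exp (s * C * integral {a..x} (\<lambda>t. sqrt ((r t)\<^sup>2 - 1)))"
    and "\<forall>x\<in>{a..b}. g x = exp (C + s * integral {a..x} (\<lambda>t. sqrt ((r t)\<^sup>2 - 1)))"
  shows "(\<forall>x\<in>{a..b}. f x > 0) \<and> f differentiable_on {a..b} \<and>
         ((\<forall>x\<in>{a..b}. f x / AM {a..b} f x = r x) \<longleftrightarrow> \<bar>C\<bar> = 1) \<and>
         (\<forall>x\<in>{a..b}. g x > 0) \<and> g differentiable_on {a..b} \<and>
         (\<forall>x\<in>{a..b}. g x / AM {a..b} g x = r x)"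
proof -
  have abs_s: "\<bar>s\<bar> = 1"
    using assms(4) by auto
  have f: "\<forall>x\<in>{a..b}. f x = exp (0 + s * C * integral {a..x} (\<lambda>t. sqrt ((r t)\<^sup>2 - 1)))"
    using assms(5) by simp
  note F = exp_integral_divide_AM[OF assms(1-3) f]
  note G = exp_integral_divide_AM[OF assms(1-3,6)]
  have "\<forall>x\<in>{a..b}. f x > 0" "\<forall>x\<in>{a..b}. g x > 0"
    using assms(5,6) by simp_all
  with F G abs_s show ?thesis
    by (simp add: abs_mult)
qed

end
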